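(* For each of the following 3-dimensional commutative complex associative algebras $C_i$ with basis $\{e_1,e_2,e_3\}$ (products of basis elements not listed are zero), a linear map $N:C_i\to C_i$ is a Nijenhuis operator if and only if it is one of the maps listed for $C_i$. Here $\langle u\mid v\mid w\rangle$ denotes the linear map with $e_1\mapsto u$, $e_2\mapsto v$, $e_3\mapsto w$, and all $n_{ij}$ are arbitrary complex numbers subject only to the stated restrictions. (1) $C_1$: $e_3\cdot e_3=e_1$. - $N^1=\langle n_{11}e_1\mid n_{21}e_1+n_{22}e_2\mid n_{31}e_1+n_{32}e_2+n_{11}e_3\rangle$; - $N^2=\langle n_{11}e_1+n_{12}e_2\mid -\frac{(n_{11}-n_{33})^2}{n_{12}}e_1+(2n_{33}-n_{11})e_2\mid n_{31}e_1+n_{32}e_2+n_{33}e_3\rangle$, $n_{12}\ne0$. (2) $C_2$: $e_i\cdot e_j=0$ for all $i,j$. - $N^1$: every linear map. (3) $C_3$: $e_2\cdot e_2=e_1,\ e_3\cdot e_3=e_1$. - $N^1=\langle n_{11}e_1\mid n_{21}e_1+n_{11}e_2\mid n_{31}e_1+n_{11}e_3\rangle$; - $N^2=\langle n_{11}e_1\mid n_{21}e_1+n_{11}e_2\mid n_{31}e_1+n_{32}e_2+(n_{11}\pm n_{32}\sqrt{-1})e_3\rangle$ (either sign), $n_{32}\ne0$; - $N^3=\langle n_{11}e_1\mid n_{21}e_1+(n_{11}\pm n_{23}\sqrt{-1})e_2+n_{23}e_3\mid n_{31}e_1+n_{11}e_3\rangle$ (either sign), $n_{23}\ne0$; - $N^4=\langle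 n_{11}e_1\mid n_{21}e_1+(n_{11}-n_{23}\sqrt{-1})e_2+n_{23}e_3\mid n_{31}e_1+n_{32}e_2+(n_{11}+n_{32}\sqrt{-1})e_3\rangle$, $n_{23},n_{32}\ne0$; - $N^5=\langle n_{11}e_1\mid n_{21}e_1+(n_{11}+n_{23}\sqrt{-1})e_2+n_{23}e_3\mid n_{31}e_1+n_{32}e_2+(n_{11}-n_{32}\sqrt{-1})e_3\rangle$, $n_{23},n_{32}\ne0$. (4) $C_4$: $e_2\cdot e_3=e_3\cdot e_2=e_1,\ e_3\cdot e_3=e_2$. - $N^1=\langle n_{11}e_1\mid n_{21}e_1+n_{11}e_2\mid n_{31}e_1+n_{32}e_2+n_{11}e_3\rangle$. (5) $C_5$: $e_1\cdot e_1=e_1,\ e_2\cdot e_2=e_2,\ e_3\cdot e_3=e_3$. - $N^1=\langle n_{11}e_1\mid n_{22}e_2\mid n_{33}e_3\rangle$; - $N^2=\langle n_{11}e_1\mid n_{22}e_2\mid n_{31}e_1+(n_{11}+n_{31})e_3\rangle$, $n_{31}\ne0$; - $N^3=\langle n_{11}e_1\mid n_{22}e_2\mid n_{32}e_2+(n_{22}+n_{32})e_3\rangle$, $n_{32}\ne0$; - $N^4=\langle n_{11}e_1\mid n_{21}e_1+(n_{11}+n_{21})e_2\mid n_{33}e_3\rangle$, $n_{21}\ne0$; - $N^5=\langle n_{11}e_1\mid (n_{23}+n_{33})e_2+n_{23}e_3\mid n_{33}e_3\rangle$, $n_{23}\ne0$; - $N^6=\langle n_{11}e_1\mid n_{21}e_1+(n_{11}+n_{21})e_2\mid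 n_{32}e_1+n_{32}e_2+(n_{11}+n_{21}+n_{32})e_3\rangle$, $n_{21},n_{32}\ne0$; - $N^7=\langle (n_{22}+n_{32}-n_{31})e_1\mid n_{22}e_2\mid n_{31}e_1+n_{32}e_2+(n_{22}+n_{32})e_3\rangle$, $n_{31},n_{32}\ne0$; - $N^8=\langle n_{11}e_1+n_{13}e_3\mid n_{22}e_2\mid (n_{11}-n_{13})e_3\rangle$, $n_{13}\ne0$; - $N^9=\langle n_{11}e_1+n_{12}e_2\mid (n_{11}-n_{12})e_2\mid n_{33}e_3\rangle$, $n_{12}\ne0$; - $N^{10}=\langle n_{11}e_1+n_{13}e_3\mid n_{23}e_1+(n_{11}+n_{23})e_2+n_{23}e_3\mid (n_{11}-n_{13})e_3\rangle$, $n_{13},n_{23}\ne0$; - $N^{11}=\langle n_{11}e_1+n_{12}e_2\mid (n_{11}-n_{12})e_2\mid n_{31}e_1+n_{31}e_2+(n_{31}+n_{11})e_3\rangle$, $n_{12},n_{31}\ne0$; - $N^{12}=\langle (n_{23}+n_{33}-n_{21})e_1\mid n_{21}e_1+(n_{23}+n_{33})e_2+n_{23}e_3\mid n_{33}e_3\rangle$, $n_{21},n_{23}\ne0$; - $N^{13}=\langle (n_{22}-n_{23}-n_{31})e_1\mid n_{23}e_1+n_{22}e_2+n_{23}e_3\mid n_{31}e_1+(n_{22}-n_{23})e_3\rangle$, $n_{31},n_{23}\ne0$; - $N^{14}=\langle n_{11}e_1+n_{12}e_2+n_{13}e_3\mid (n_{11}-n_{12})e_2\mid (n_{11}-n_{13})e_3\rangle$,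 $n_{12},n_{13}\ne0$; - $N^{15}=\langle n_{11}e_1+n_{12}e_2+n_{12}e_3\mid (n_{11}-n_{12}-n_{32})e_2\mid n_{32}e_2+(n_{11}-n_{12})e_3\rangle$, $n_{12},n_{32}\ne0$; - $N^{16}=\langle n_{11}e_1+n_{12}e_2+n_{12}e_3\mid (n_{11}-n_{12})e_2+n_{23}e_3\mid (n_{11}-n_{12}-n_{23})e_3\rangle$, $n_{12},n_{23}\ne0$. (6) $C_6$: $e_2\cdot e_2=e_2,\ e_3\cdot e_3=e_3$. - $N^1=\langle n_{11}e_1\mid n_{22}e_2\mid n_{33}e_3\rangle$; - $N^2=\langle n_{11}e_1\mid n_{22}e_2\mid n_{31}e_1+n_{11}e_3\rangle$, $n_{31}\ne0$; - $N^3=\langle n_{11}e_1\mid n_{21}e_1+n_{11}e_2\mid n_{33}e_3\rangle$, $n_{21}\ne0$; - $N^4=\langle n_{11}e_1\mid n_{21}e_1+n_{11}e_2\mid n_{31}e_1+n_{11}e_3\rangle$, $n_{21},n_{31}\ne0$; - $N^5=\langle n_{11}e_1\mid n_{22}e_2\mid n_{32}e_2+(n_{22}+n_{32})e_3\rangle$, $n_{32}\ne0$; - $N^6=\langle n_{11}e_1\mid (n_{23}+n_{33})e_2+n_{23}e_3\mid n_{33}e_3\rangle$, $n_{23}\ne0$; - $N^7=\langle (n_{22}+n_{32})e_1\mid n_{22}e_2\mid n_{31}e_1+n_{32}e_2+(n_{22}+n_{32})e_3\rangle$, $n_{31},n_{32}\ne0$; - $N^8=\langle (n_{23}+n_{33})e_1\mid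 n_{21}e_1+(n_{23}+n_{33})e_2+n_{23}e_3\mid n_{33}e_3\rangle$, $n_{21},n_{23}\ne0$. (7) $C_7$: $e_1\cdot e_3=e_3\cdot e_1=e_1,\ e_2\cdot e_2=e_2,\ e_3\cdot e_3=e_3$. - $N^1=\langle n_{11}e_1\mid n_{22}e_2\mid n_{33}e_3\rangle$; - $N^2=\langle n_{11}e_1\mid n_{22}e_2\mid n_{31}e_1+n_{11}e_3\rangle$, $n_{31}\ne0$; - $N^3=\langle n_{11}e_1\mid n_{21}e_1+n_{11}e_2\mid n_{31}e_1+n_{11}e_3\rangle$, $n_{21}\ne0$; - $N^4=\langle (n_{22}+n_{32})e_1\mid n_{22}e_2\mid n_{31}e_1+n_{32}e_2+(n_{22}+n_{32})e_3\rangle$, $n_{31},n_{32}\ne0$; - $N^5=\langle n_{11}e_1\mid n_{22}e_2\mid n_{32}e_2+(n_{22}+n_{32})e_3\rangle$, $n_{32}\ne0$; - $N^6=\langle n_{11}e_1\mid (n_{23}+n_{33})e_2+n_{23}e_3\mid n_{33}e_3\rangle$, $n_{23}\ne0$; - $N^7=\langle n_{22}e_1\mid n_{21}e_1+n_{22}e_2\mid -n_{21}e_1+n_{32}e_2+(n_{22}+n_{32})e_3\rangle$, $n_{21},n_{32}\ne0$; - $N^8=\langle n_{11}e_1\mid n_{21}e_1+(n_{23}+n_{11})e_2+n_{23}e_3\mid -n_{21}e_1+n_{11}e_3\rangle$, $n_{21},n_{23}\ne0$. (8) $C_8$: $e_3\cdot e_3=e_3$. - $N^1=\langle n_{11}e_1+n_{12}e_2\mid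 n_{21}e_1+n_{22}e_2\mid n_{33}e_3\rangle$; - $N^2=\langle n_{11}e_1+n_{12}e_2\mid n_{22}e_2\mid n_{32}e_2+n_{22}e_3\rangle$, $n_{32}\ne0$; - $N^3=\langle (n_{33}-\frac{n_{21}n_{32}}{n_{31}})e_1+\frac{n_{32}n_{33}-n_{22}n_{32}}{n_{31}}e_2\mid n_{21}e_1+n_{22}e_2\mid n_{31}e_1+n_{32}e_2+n_{33}e_3\rangle$, $n_{31}\ne0$. (9) $C_9$: $e_1\cdot e_3=e_3\cdot e_1=e_1,\ e_3\cdot e_3=e_3$. - $N^1=\langle n_{11}e_1\mid n_{22}e_2\mid n_{33}e_3\rangle$; - $N^2=\langle n_{11}e_1\mid n_{22}e_2\mid n_{32}e_2+n_{22}e_3\rangle$, $n_{32}\ne0$; - $N^3=\langle n_{11}e_1\mid n_{22}e_2\mid n_{31}e_1+n_{11}e_3\rangle$, $n_{31}\ne0$; - $N^4=\langle n_{11}e_1\mid n_{11}e_2\mid n_{31}e_1+n_{32}e_2+n_{11}e_3\rangle$, $n_{31},n_{32}\ne0$; - $N^5=\langle n_{11}e_1\mid n_{21}e_1+n_{22}e_2\mid n_{31}e_1+n_{11}e_3\rangle$, $n_{21}\ne0$; - $N^6=\langle n_{11}e_1+n_{12}e_2\mid n_{22}e_2\mid n_{32}e_2+n_{22}e_3\rangle$, $n_{12}\ne0$. (10) $C_{10}$: $e_1\cdot e_3=e_3\cdot e_1=e_1,\ e_2\cdot e_3=e_3\cdot e_2=e_2,\ e_3\cdot e_3=e_3$.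 - $N^1=\langle n_{11}e_1+n_{12}e_2\mid n_{21}e_1+n_{22}e_2\mid n_{33}e_3\rangle$; - $N^2=\langle n_{11}e_1+n_{12}e_2\mid n_{22}e_2\mid n_{32}e_2+n_{22}e_3\rangle$, $n_{32}\ne0$; - $N^3=\langle (n_{33}-\frac{n_{21}n_{32}}{n_{31}})e_1+\frac{n_{32}n_{33}-n_{22}n_{32}}{n_{31}}e_2\mid n_{21}e_1+n_{22}e_2\mid n_{31}e_1+n_{32}e_2+n_{33}e_3\rangle$, $n_{31}\ne0$. (11) $C_{11}$: $e_1\cdot e_1=e_2,\ e_3\cdot e_3=e_3$. - $N^1=\langle n_{11}e_1+n_{12}e_2\mid n_{11}e_2\mid n_{33}e_3\rangle$; - $N^2=\langle n_{11}e_1+n_{12}e_2\mid n_{11}e_2\mid n_{32}e_2+n_{11}e_3\rangle$, $n_{32}\ne0$; - $N^3=\langle n_{11}e_1-n_{31}e_2\mid n_{11}e_2\mid n_{31}e_1+n_{32}e_2+n_{11}e_3\rangle$, $n_{31}\ne0$. (12) $C_{12}$: $e_1\cdot e_1=e_2,\ e_1\cdot e_3=e_3\cdot e_1=e_1,\ e_2\cdot e_3=e_3\cdot e_2=e_2,\ e_3\cdot e_3=e_3$. - $N^1=\langle n_{11}e_1+n_{12}e_2\mid n_{11}e_2\mid n_{33}e_3\rangle$; - $N^2=\langle n_{11}e_1+n_{12}e_2\mid n_{11}e_2\mid n_{32}e_2+n_{11}e_3\rangle$, $n_{32}\ne0$; - $N^3=\langle n_{11}e_1+n_{31}e_2\mid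 n_{11}e_2\mid n_{31}e_1+n_{32}e_2+n_{11}e_3\rangle$, $n_{31}\ne0$.
   Context: A Nijenhuis operator on an algebra $(A,\cdot)$ over $\mathbb C$ is a linear map $N:A\to A$ such that $N(x)\cdot N(y)=N\big(N(x)\cdot y+x\cdot N(y)-N(x\cdot y)\big)$ for all $x,y\in A$. *)

theory Defs
  imports "HOL-Analysis.Analysis"
begin

(* The plain constant "linear" means linearity over the reals; complex linearity on
   complex ^ 'n is Vector_Spaces.linear for the scalar multiplication *s. *)

definition bilinear_product ::
    "(complex ^ 'n \<Rightarrow> complex ^ 'n \<Rightarrow> complex ^ 'n) \<Rightarrow> bool"
  where "bilinear_product m \<longleftrightarrow>
    (\<forall>x. Vector_Spaces.linear (*s) (*s) (\<lambda>y. m x y)) \<and>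
    (\<forall>y. Vector_Spaces.linear (*s) (*s) (\<lambda>x. m x y))"

definition comm_assoc_algebra ::
    "(complex ^ 'n \<Rightarrow> complex ^ 'n \<Rightarrow> complex ^ 'n) \<Rightarrow> bool"
  where "comm_assoc_algebra m \<longleftrightarrow> bilinear_product m \<and>
    (\<forall>x y. m x y = m y x) \<and> (\<forall>x y z. m (m x y) z = m x (m y z))"

definition nijenhuis_operator ::
    "(complex ^ 'n \<Rightarrow> complex ^ 'n \<Rightarrow> complex ^ 'n) \<Rightarrow> (complex ^ 'n \<Rightarrow> complex ^ 'n) \<Rightarrow> bool"
  where "nijenhuis_operator m N \<longleftrightarrow> Vector_Spaces.linear (*s) (*s) N \<and>
    (\<forall>x y. m (N x) (N y) = N (m (N x) y + m x (N y) - N (m x y)))"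

(* In the three-element index type, the numeral 3 denotes the same index as 0; 1, 2 and 3 are
   the three distinct indices. *)
abbreviation e1 :: "complex ^ 3" where "e1 \<equiv> axis 1 1"
abbreviation e2 :: "complex ^ 3" where "e2 \<equiv> axis 2 1"
abbreviation e3 :: "complex ^ 3" where "e3 \<equiv> axis 3 1"

(* The bilinear product for which the product of the i-th and j-th basis vectors is c i j. *)
definition product_of_table ::
    "('n \<Rightarrow> 'n \<Rightarrow> complex ^ 'n) \<Rightarrow> complex ^ 'n \<Rightarrow> complex ^ 'n \<Rightarrow> complex ^ ('n::finite)"
  where "product_of_table c x y = (\<Sum>i\<in>UNIV. \<Sum>j\<in>UNIV. (x $ i * y $ j) *s c i j)"

definition linear_map_of ::
    "complex ^ 3 \<Rightarrow> complex ^ 3 \<Rightarrow> complex ^ 3 \<Rightarrow> complex ^ 3 \<Rightarrow> complex ^ 3"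
    ("\<langle>_ \<mid> _ \<mid> _\<rangle>")
  where "\<langle>u \<mid> v \<mid> w\<rangle> = (\<lambda>x. x $ 1 *s u + x $ 2 *s v + x $ 3 *s w)"

definition C1 :: "complex ^ 3 \<Rightarrow> complex ^ 3 \<Rightarrow> complex ^ 3" where
  "C1 = product_of_table (\<lambda>i j. if (i, j) = (3, 3) then e1 else 0)"

definition C2 :: "complex ^ 3 \<Rightarrow> complex ^ 3 \<Rightarrow> complex ^ 3" where
  "C2 = product_of_table (\<lambda>i j. 0)"

definition C3 :: "complex ^ 3 \<Rightarrow> complex ^ 3 \<Rightarrow> complex ^ 3" where
  "C3 = product_of_table (\<lambda>i j. if (i, j) = (2, 2) then e1 else if (i, j) = (3, 3) then e1 else 0)"

definition C4 :: "complex ^ 3 \<Rightarrow> complex ^ 3 \<Rightarrow> complex ^ 3" where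
  "C4 = product_of_table (\<lambda>i j.
     if (i, j) \<in> {(2, 3), (3, 2)} then e1 else if (i, j) = (3, 3) then e2 else 0)"

definition C5 :: "complex ^ 3 \<Rightarrow> complex ^ 3 \<Rightarrow> complex ^ 3" where
  "C5 = product_of_table (\<lambda>i j.
     if (i, j) = (1, 1) then e1 else if (i, j) = (2, 2) then e2
     else if (i, j) = (3, 3) then e3 else 0)"

definition C6 :: "complex ^ 3 \<Rightarrow> complex ^ 3 \<Rightarrow> complex ^ 3" where
  "C6 = product_of_table (\<lambda>i j. if (i, j) = (2, 2) then e2 else if (i, j) = (3, 3) then e3 else 0)"

definition C7 :: "complex ^ 3 \<Rightarrow> complex ^ 3 \<Rightarrow> complex ^ 3" where
  "C7 = product_of_table (\<lambda>i j.
     if (i, j) \<in> {(1, 3), (3, 1)} then e1 else if (i, j) = (2, 2) then e2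
     else if (i, j) = (3, 3) then e3 else 0)"

definition C8 :: "complex ^ 3 \<Rightarrow> complex ^ 3 \<Rightarrow> complex ^ 3" where
  "C8 = product_of_table (\<lambda>i j. if (i, j) = (3, 3) then e3 else 0)"

definition C9 :: "complex ^ 3 \<Rightarrow> complex ^ 3 \<Rightarrow> complex ^ 3" where
  "C9 = product_of_table (\<lambda>i j.
     if (i, j) \<in> {(1, 3), (3, 1)} then e1 else if (i, j) = (3, 3) then e3 else 0)"

definition C10 :: "complex ^ 3 \<Rightarrow> complex ^ 3 \<Rightarrow> complex ^ 3" where
  "C10 = product_of_table (\<lambda>i j.
     if (i, j) \<in> {(1, 3), (3, 1)} then e1 else if (i, j) \<in> {(2, 3), (3, 2)} then e2
     else if (i, j) = (3, 3) then e3 else 0)"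

definition C11 :: "complex ^ 3 \<Rightarrow> complex ^ 3 \<Rightarrow> complex ^ 3" where
  "C11 = product_of_table (\<lambda>i j. if (i, j) = (1, 1) then e2 else if (i, j) = (3, 3) then e3 else 0)"

definition C12 :: "complex ^ 3 \<Rightarrow> complex ^ 3 \<Rightarrow> complex ^ 3" where
  "C12 = product_of_table (\<lambda>i j.
     if (i, j) = (1, 1) then e2 else if (i, j) \<in> {(1, 3), (3, 1)} then e1
     else if (i, j) \<in> {(2, 3), (3, 2)} then e2 else if (i, j) = (3, 3) then e3 else 0)"

lemma product_of_table_axis: "product_of_table c (axis i 1) (axis j 1) = c i j"
proof -
  have "product_of_table c (axis i 1) (axis j 1)
      = (\<Sum>k\<in>UNIV. \<Sum>l\<in>UNIV. if l = j then (if k = i then c i j else 0) else 0)"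
    unfolding product_of_table_def by (intro sum.cong refl) (auto simp: axis_def)
  then show ?thesis by simp
qed

lemma bilinear_product_of_table: "bilinear_product (product_of_table c)"
  unfolding bilinear_product_def
  by (auto intro!: vec.linear_compose_sum simp: Vector_Spaces.linear_iff product_of_table_def
      vec.scale_sum_right sum.distrib algebra_simps vec.scale_left_distrib
      intro: vec.vector_space_axioms)

lemma linear_linear_map_of: "Vector_Spaces.linear (*s) (*s) \<langle>u \<mid> v \<mid> w\<rangle>"
  by (auto simp: Vector_Spaces.linear_iff linear_map_of_def vec_eq_iff algebra_simps
      intro: vec.vector_space_axioms)

lemma linear_map_of_unique:
  "N = \<langle>u \<mid> v \<mid> w\<rangle> \<longleftrightarrow>
    Vector_Spaces.linear (*s) (*s) N \<and> N e1 = u \<and> N e2 = v \<and> N e3 = w"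
proof
  assume "N = \<langle>u \<mid> v \<mid> w\<rangle>"
  then show "Vector_Spaces.linear (*s) (*s) N \<and> N e1 = u \<and> N e2 = v \<and> N e3 = w"
    using linear_linear_map_of by (simp add: linear_map_of_def axis_def)
next
  assume N: "Vector_Spaces.linear (*s) (*s) N \<and> N e1 = u \<and> N e2 = v \<and> N e3 = w"
  show "N = \<langle>u \<mid> v \<mid> w\<rangle>"
  proof
    fix x :: "complex ^ 3"
    have "x = x $ 1 *s e1 + x $ 2 *s e2 + x $ 3 *s e3"
      by (simp add: vec_eq_iff forall_3 axis_def)
    then have "N x = N (x $ 1 *s e1 + x $ 2 *s e2 + x $ 3 *s e3)" by simp
    also have "\<dots> = \<langle>u \<mid> v \<mid> w\<rangle> x"
      using N by (auto simp: Vector_Spaces.linear_iff linear_map_of_def)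
    finally show "N x = \<langle>u \<mid> v \<mid> w\<rangle> x" .
  qed
qed

lemmas C_defs = C1_def C2_def C3_def C4_def C5_def C6_def C7_def C8_def C9_def C10_def C11_def C12_def

lemma comm_assoc_algebras:
  "comm_assoc_algebra C1" "comm_assoc_algebra C2" "comm_assoc_algebra C3"
  "comm_assoc_algebra C4" "comm_assoc_algebra C5" "comm_assoc_algebra C6"
  "comm_assoc_algebra C7" "comm_assoc_algebra C8" "comm_assoc_algebra C9"
  "comm_assoc_algebra C10" "comm_assoc_algebra C11" "comm_assoc_algebra C12"
  unfolding comm_assoc_algebra_def C_defs
  by (simp_all add: bilinear_product_of_table)
     (simp_all add: product_of_table_def sum_3 vec_eq_iff forall_3 axis_def algebra_simps)

end

(* The Nijenhuis identity is bilinear and symmetric in its two arguments, so it only has to be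
   checked on the six unordered pairs of basis vectors. For N with matrix entries a, ..., k this
   is a system of quadratic equations. Once one knows which off-diagonal entries vanish, every
   equation factors and the system becomes linear in the remaining entries; only C3 leaves genuine
   quadrics (e - a)^2 + f^2 = 0, which split over the complex numbers. *)

theory Submission
  imports Defs
begin

section \<open>Reduction of the identity to pairs of basis vectors\<close>

lemma linear_basis_expansion:
  fixes f :: "complex ^ 'n \<Rightarrow> complex ^ 'm"
  assumes "Vector_Spaces.linear (*s) (*s) f"
  shows "f x = (\<Sum>i\<in>UNIV. x $ i *s f (axis i 1))"
proof -
  have "f x = f (\<Sum>i\<in>UNIV. x $ i *s axis i 1)" by (simp add: basis_expansion)
  also have "\<dots> = (\<Sum>i\<in>UNIV. x $ i *s f (axis i 1))"
    by (simp add: vec.linear_sum[OF assms] vec.linear_scale[OF assms])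
  finally show ?thesis .
qed

lemma bilinear_product_zero_if_axis:
  assumes "bilinear_product D" and "\<And>i j. D (axis i 1) (axis j 1) = 0"
  shows "D x y = 0"
proof -
  \<comment> \<open>The arguments are expanded one at a time: first \<open>y\<close>, with a basis
    vector on the left, then \<open>x\<close>.\<close>
  have "D (axis i 1) y = 0" for i
    using linear_basis_expansion[of "D (axis i 1)" y] assms by (simp add: bilinear_product_def)
  then show ?thesis
    using linear_basis_expansion[of "\<lambda>x. D x y" x] assms(1) by (simp add: bilinear_product_def)
qed

text \<open>For linear \<open>N\<close> each term of the identity is linear in \<open>x\<close> and
  in \<open>y\<close>. Hence the difference \<open>D\<close> of the two sides is a bilinear product,
  and it vanishes once it does so on basis pairs.\<close>

lemma nijenhuis_operator_iff_axis:
  assumes m: "bilinear_product m"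
  shows "nijenhuis_operator m N \<longleftrightarrow> Vector_Spaces.linear (*s) (*s) N \<and>
    (\<forall>i j. m (N (axis i 1)) (N (axis j 1)) =
      N (m (N (axis i 1)) (axis j 1) + m (axis i 1) (N (axis j 1)) - N (m (axis i 1) (axis j 1))))"
    (is "?L \<longleftrightarrow> ?N \<and> ?R")
proof
  assume "?N \<and> ?R"
  then have N: ?N and R: ?R by auto
  define D where "D x y = m (N x) (N y) - N (m (N x) y + m x (N y) - N (m x y))" for x y
  have "bilinear_product D"
    using m N unfolding bilinear_product_def D_def vec.linear_diff[OF N]
    by (simp add: Vector_Spaces.linear_iff vec.vector_space_axioms algebra_simps
        vec.scale_right_distrib vec.scale_right_diff_distrib)
  moreover have "D (axis i 1) (axis j 1) = 0" for i j
    using R by (simp add: D_def)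
  ultimately have "D x y = 0" for x y
    by (rule bilinear_product_zero_if_axis)
  then show ?L
    using N by (simp add: nijenhuis_operator_def D_def)
qed (auto simp: nijenhuis_operator_def)

section \<open>Linear maps in coordinates\<close>

definition matrix_map :: "complex \<Rightarrow> complex \<Rightarrow> complex \<Rightarrow> complex \<Rightarrow> complex \<Rightarrow> complex \<Rightarrow>
    complex \<Rightarrow> complex \<Rightarrow> complex \<Rightarrow> complex ^ 3 \<Rightarrow> complex ^ 3"
  where "matrix_map a b c d e f g h k =
    \<langle>a *s e1 + b *s e2 + c *s e3 \<mid> d *s e1 + e *s e2 + f *s e3 \<mid> g *s e1 + h *s e2 + k *s e3\<rangle>"

lemma basis_components:
  "e1 $ 1 = 1" "e1 $ 2 = 0" "e1 $ 3 = 0" "e2 $ 1 = 0" "e2 $ 2 = 1" "e2 $ 3 = 0"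
  "e3 $ 1 = 0" "e3 $ 2 = 0" "e3 $ 3 = 1"
  by (simp_all add: axis_def)

text \<open>The letters \<open>a\<close>, ..., \<open>k\<close> are the entries n11, ..., n33, each
  row being the image of a basis vector. Membership in a listed family thus becomes nine scalar
  equations, from which the existential parameters can be eliminated.\<close>

lemma matrix_map_eq_iff:
  "matrix_map a b c d e f g h k = \<langle>u \<mid> v \<mid> w\<rangle> \<longleftrightarrow>
    a = u $ 1 \<and> b = u $ 2 \<and> c = u $ 3 \<and> d = v $ 1 \<and> e = v $ 2 \<and> f = v $ 3 \<and>
    g = w $ 1 \<and> h = w $ 2 \<and> k = w $ 3"
  unfolding linear_map_of_unique
  by (auto simp: matrix_map_def linear_linear_map_of)
     (auto simp: linear_map_of_def basis_components vec_eq_iff forall_3)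

lemma linear_matrix_map: "Vector_Spaces.linear (*s) (*s) (matrix_map a b c d e f g h k)"
  by (simp add: matrix_map_def linear_linear_map_of)

lemma linear_iff_matrix_map:
  "Vector_Spaces.linear (*s) (*s) N \<longleftrightarrow>
    (\<exists>a b c d e f g h k. N = matrix_map a b c d e f g h k)"
proof
  assume "Vector_Spaces.linear (*s) (*s) N"
  then have "N = \<langle>N e1 \<mid> N e2 \<mid> N e3\<rangle>" by (simp add: linear_map_of_unique)
  then have "matrix_map (N e1 $ 1) (N e1 $ 2) (N e1 $ 3) (N e2 $ 1) (N e2 $ 2) (N e2 $ 3)
      (N e3 $ 1) (N e3 $ 2) (N e3 $ 3) = N"
    using matrix_map_eq_iff by metis
  then show "\<exists>a b c d e f g h k. N = matrix_map a b c d e f g h k" by metis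
qed (auto simp: linear_matrix_map)

text \<open>Allows each algebra to be treated on maps given by entries. A non-linear
  \<open>N\<close> makes both sides false, the right one by the first assumption.\<close>

lemma nijenhuis_classification:
  assumes "\<And>N. Q N \<Longrightarrow> Vector_Spaces.linear (*s) (*s) N"
    and "\<And>a b c d e f g h k. nijenhuis_operator m (matrix_map a b c d e f g h k) \<longleftrightarrow>
      Q (matrix_map a b c d e f g h k)"
  shows "\<forall>N. nijenhuis_operator m N \<longleftrightarrow> Q N"
proof
  fix N
  show "nijenhuis_operator m N \<longleftrightarrow> Q N"
  proof (cases "Vector_Spaces.linear (*s) (*s) N")
    case True
    then show ?thesis using assms(2) by (auto simp: linear_iff_matrix_map)
  next
    case False
    then show ?thesis using assms(1) by (auto simp: nijenhuis_operator_def)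
  qed
qed

lemma matrix_map_components:
  "matrix_map a b c d e f g h k x $ 1 = x $ 1 * a + x $ 2 * d + x $ 3 * g"
  "matrix_map a b c d e f g h k x $ 2 = x $ 1 * b + x $ 2 * e + x $ 3 * h"
  "matrix_map a b c d e f g h k x $ 3 = x $ 1 * c + x $ 2 * f + x $ 3 * k"
  by (simp_all add: matrix_map_def linear_map_of_def basis_components)

text \<open>Commutativity makes the condition symmetric in \<open>x\<close> and \<open>y\<close>,
  which cuts nine basis pairs down to six.\<close>

lemma nijenhuis_matrix_map_iff:
  assumes m: "comm_assoc_algebra m" and N: "N = matrix_map a b c d e f g h k"
  shows "nijenhuis_operator m N \<longleftrightarrow>
    (\<forall>(x, y) \<in> {(e1, e1), (e1, e2), (e1, e3), (e2, e2), (e2, e3), (e3, e3)}.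
      m (N x) (N y) = N (m (N x) y + m x (N y) - N (m x y)))"
proof -
  define E where "E x y \<longleftrightarrow> m (N x) (N y) = N (m (N x) y + m x (N y) - N (m x y))" for x y
  have comm: "m x y = m y x" for x y
    using m unfolding comm_assoc_algebra_def by blast
  have "E x y \<longleftrightarrow> E y x" for x y
    unfolding E_def comm[of "N y" "N x"] comm[of "N y" x] comm[of y "N x"] comm[of y x]
    by (simp only: add.commute)
  moreover have "nijenhuis_operator m N \<longleftrightarrow> (\<forall>i j. E (axis i 1) (axis j 1))"
    using nijenhuis_operator_iff_axis[of m N] m linear_matrix_map
    by (simp add: N E_def comm_assoc_algebra_def)
  ultimately show ?thesis
    unfolding E_def[symmetric] by (simp add: forall_3) blast
qed

section \<open>Scalar equations and their factorizations\<close>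

lemma C_components:
  "C1 x y $ 1 = x $ 3 * y $ 3" "C1 x y $ 2 = 0" "C1 x y $ 3 = 0"
  "C3 x y $ 1 = x $ 2 * y $ 2 + x $ 3 * y $ 3" "C3 x y $ 2 = 0" "C3 x y $ 3 = 0"
  "C4 x y $ 1 = x $ 2 * y $ 3 + x $ 3 * y $ 2" "C4 x y $ 2 = x $ 3 * y $ 3" "C4 x y $ 3 = 0"
  "C5 x y $ 1 = x $ 1 * y $ 1" "C5 x y $ 2 = x $ 2 * y $ 2" "C5 x y $ 3 = x $ 3 * y $ 3"
  "C6 x y $ 1 = 0" "C6 x y $ 2 = x $ 2 * y $ 2" "C6 x y $ 3 = x $ 3 * y $ 3"
  "C7 x y $ 1 = x $ 1 * y $ 3 + x $ 3 * y $ 1" "C7 x y $ 2 = x $ 2 * y $ 2" "C7 x y $ 3 = x $ 3 * y $ 3"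
  "C8 x y $ 1 = 0" "C8 x y $ 2 = 0" "C8 x y $ 3 = x $ 3 * y $ 3"
  "C9 x y $ 1 = x $ 1 * y $ 3 + x $ 3 * y $ 1" "C9 x y $ 2 = 0" "C9 x y $ 3 = x $ 3 * y $ 3"
  "C10 x y $ 1 = x $ 1 * y $ 3 + x $ 3 * y $ 1" "C10 x y $ 2 = x $ 2 * y $ 3 + x $ 3 * y $ 2"
  "C10 x y $ 3 = x $ 3 * y $ 3"
  "C11 x y $ 1 = 0" "C11 x y $ 2 = x $ 1 * y $ 1" "C11 x y $ 3 = x $ 3 * y $ 3"
  "C12 x y $ 1 = x $ 1 * y $ 3 + x $ 3 * y $ 1" "C12 x y $ 2 = x $ 1 * y $ 1 + x $ 2 * y $ 3 + x $ 3 * y $ 2"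
  "C12 x y $ 3 = x $ 3 * y $ 3"
  unfolding C_defs
  by (simp_all add: product_of_table_def sum_3 basis_components)

lemmas nijenhuis_expand = nijenhuis_matrix_map_iff[OF _ refl] comm_assoc_algebras vec_eq_iff forall_3
  basis_components matrix_map_components C_components

text \<open>Zero-product splittings. The first serves equations such as
  \<open>h * h = k * h - h * e\<close> for \<open>C6\<close>, which tie an off-diagonal entry to a
  difference of diagonal ones; the fourth is \<open>(x - y)^2 = 0\<close>.\<close>

lemma factor:
  fixes x y z :: "'a :: idom"
  shows "x * x = y * x - x * z \<longleftrightarrow> x = 0 \<or> y = x + z"
    and "x * z + y * z = 0 \<longleftrightarrow> z = 0 \<or> y = - x"
    and "x * z + z * y = 0 \<longleftrightarrow> z = 0 \<or> y = - x"
    and "x * x = (2 * x - y) * y \<longleftrightarrow> x = y"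
  by algebra+

text \<open>Since \<open>(2 * e - a) * a = e^2 - (e - a)^2\<close>, both equations say
  \<open>(e - a)^2 + f^2 = 0\<close>. The two orders of the summands match the pairs
  \<open>(e2, e2)\<close> and \<open>(e3, e3)\<close> of \<open>C3\<close>.\<close>

lemma sum_of_squares_factor:
  "e * e + f * f = (2 * e - a) * a \<longleftrightarrow> e = a + f * \<i> \<or> e = a - f * \<i>"
  "f * f + e * e = (2 * e - a) * a \<longleftrightarrow> e = a + f * \<i> \<or> e = a - f * \<i>"
proof -
  have "e * e + f * f - (2 * e - a) * a = (e - (a + f * \<i>)) * (e - (a - f * \<i>))"
    by (simp add: algebra_simps)
  then show "e * e + f * f = (2 * e - a) * a \<longleftrightarrow> e = a + f * \<i> \<or> e = a - f * \<i>"
    by (metis eq_iff_diff_eq_0 mult_eq_0_iff)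
  then show "f * f + e * e = (2 * e - a) * a \<longleftrightarrow> e = a + f * \<i> \<or> e = a - f * \<i>"
    by (simp add: add.commute)
qed

text \<open>Clears the denominator \<open>n31\<close> in the third families of \<open>C8\<close> and
  \<open>C10\<close>.\<close>

lemma eq_divide_iff:
  fixes x y z w :: "'a :: field"
  assumes "z \<noteq> 0"
  shows "x = w - y / z \<longleftrightarrow> z * x + y = w * z" "x = y / z \<longleftrightarrow> x * z = y"
  using assms by (auto simp: field_simps)

text \<open>Removes the sign parameter from the second and third families of
  \<open>C3\<close>.\<close>

lemma ex_sign:
  "(\<exists>s. (s = 1 \<or> s = - 1) \<and> P s) \<longleftrightarrow> P 1 \<or> P (- 1)"
  by auto

section \<open>The twelve algebras, one by one\<close>

theorem theorem4p1:
  shows "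
    (\<forall>N. nijenhuis_operator C1 N \<longleftrightarrow>
      (\<exists>n11 n21 n22 n31 n32. N = \<langle>n11 *s e1 \<mid> n21 *s e1 + n22 *s e2 \<mid> n31 *s e1 + n32 *s e2 + n11 *s e3\<rangle>) \<or>
      (\<exists>n11 n12 n31 n32 n33. n12 \<noteq> 0 \<and> N = \<langle>n11 *s e1 + n12 *s e2 \<mid> (- ((n11 - n33)\<^sup>2 / n12)) *s e1 + (2 * n33 - n11) *s e2 \<mid> n31 *s e1 + n32 *s e2 + n33 *s e3\<rangle>)) \<and>
    (\<forall>N. nijenhuis_operator C2 N \<longleftrightarrow>
      Vector_Spaces.linear (*s) (*s) N) \<and>
    (\<forall>N. nijenhuis_operator C3 N \<longleftrightarrow>
      (\<exists>n11 n21 n31. N = \<langle>n11 *s e1 \<mid> n21 *s e1 + n11 *s e2 \<mid> n31 *s e1 + n11 *s e3\<rangle>) \<or>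
      (\<exists>n11 n21 n31 n32 s. n32 \<noteq> 0 \<and> s \<in> {1, -1} \<and> N = \<langle>n11 *s e1 \<mid> n21 *s e1 + n11 *s e2 \<mid> n31 *s e1 + n32 *s e2 + (n11 + s * n32 * \<i>) *s e3\<rangle>) \<or>
      (\<exists>n11 n21 n23 n31 s. n23 \<noteq> 0 \<and> s \<in> {1, -1} \<and> N = \<langle>n11 *s e1 \<mid> n21 *s e1 + (n11 + s * n23 * \<i>) *s e2 + n23 *s e3 \<mid> n31 *s e1 + n11 *s e3\<rangle>) \<or>
      (\<exists>n11 n21 n23 n31 n32. n23 \<noteq> 0 \<and> n32 \<noteq> 0 \<and> N = \<langle>n11 *s e1 \<mid> n21 *s e1 + (n11 - n23 * \<i>) *s e2 + n23 *s e3 \<mid> n31 *s e1 + n32 *s e2 + (n11 + n32 * \<i>) *s e3\<rangle>) \<or>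
      (\<exists>n11 n21 n23 n31 n32. n23 \<noteq> 0 \<and> n32 \<noteq> 0 \<and> N = \<langle>n11 *s e1 \<mid> n21 *s e1 + (n11 + n23 * \<i>) *s e2 + n23 *s e3 \<mid> n31 *s e1 + n32 *s e2 + (n11 - n32 * \<i>) *s e3\<rangle>)) \<and>
    (\<forall>N. nijenhuis_operator C4 N \<longleftrightarrow>
      (\<exists>n11 n21 n31 n32. N = \<langle>n11 *s e1 \<mid> n21 *s e1 + n11 *s e2 \<mid> n31 *s e1 + n32 *s e2 + n11 *s e3\<rangle>)) \<and>
    (\<forall>N. nijenhuis_operator C5 N \<longleftrightarrow>
      (\<exists>n11 n22 n33. N = \<langle>n11 *s e1 \<mid> n22 *s e2 \<mid> n33 *s e3\<rangle>) \<or>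
      (\<exists>n11 n22 n31. n31 \<noteq> 0 \<and> N = \<langle>n11 *s e1 \<mid> n22 *s e2 \<mid> n31 *s e1 + (n11 + n31) *s e3\<rangle>) \<or>
      (\<exists>n11 n22 n32. n32 \<noteq> 0 \<and> N = \<langle>n11 *s e1 \<mid> n22 *s e2 \<mid> n32 *s e2 + (n22 + n32) *s e3\<rangle>) \<or>
      (\<exists>n11 n21 n33. n21 \<noteq> 0 \<and> N = \<langle>n11 *s e1 \<mid> n21 *s e1 + (n11 + n21) *s e2 \<mid> n33 *s e3\<rangle>) \<or>
      (\<exists>n11 n23 n33. n23 \<noteq> 0 \<and> N = \<langle>n11 *s e1 \<mid> (n23 + n33) *s e2 + n23 *s e3 \<mid> n33 *s e3\<rangle>) \<or>
      (\<exists>n11 n21 n32. n21 \<noteq> 0 \<and> n32 \<noteq> 0 \<and> N = \<langle>n11 *s e1 \<mid> n21 *s e1 + (n11 + n21) *s e2 \<mid> n32 *s e1 + n32 *s e2 + (n11 + n21 + n32) *s e3\<rangle>) \<or>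
      (\<exists>n22 n31 n32. n31 \<noteq> 0 \<and> n32 \<noteq> 0 \<and> N = \<langle>(n22 + n32 - n31) *s e1 \<mid> n22 *s e2 \<mid> n31 *s e1 + n32 *s e2 + (n22 + n32) *s e3\<rangle>) \<or>
      (\<exists>n11 n13 n22. n13 \<noteq> 0 \<and> N = \<langle>n11 *s e1 + n13 *s e3 \<mid> n22 *s e2 \<mid> (n11 - n13) *s e3\<rangle>) \<or>
      (\<exists>n11 n12 n33. n12 \<noteq> 0 \<and> N = \<langle>n11 *s e1 + n12 *s e2 \<mid> (n11 - n12) *s e2 \<mid> n33 *s e3\<rangle>) \<or>
      (\<exists>n11 n13 n23. n13 \<noteq> 0 \<and> n23 \<noteq> 0 \<and> N = \<langle>n11 *s e1 + n13 *s e3 \<mid> n23 *s e1 + (n11 + n23) *s e2 + n23 *s e3 \<mid> (n11 - n13) *s e3\<rangle>) \<or>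
      (\<exists>n11 n12 n31. n12 \<noteq> 0 \<and> n31 \<noteq> 0 \<and> N = \<langle>n11 *s e1 + n12 *s e2 \<mid> (n11 - n12) *s e2 \<mid> n31 *s e1 + n31 *s e2 + (n31 + n11) *s e3\<rangle>) \<or>
      (\<exists>n21 n23 n33. n21 \<noteq> 0 \<and> n23 \<noteq> 0 \<and> N = \<langle>(n23 + n33 - n21) *s e1 \<mid> n21 *s e1 + (n23 + n33) *s e2 + n23 *s e3 \<mid> n33 *s e3\<rangle>) \<or>
      (\<exists>n22 n23 n31. n31 \<noteq> 0 \<and> n23 \<noteq> 0 \<and> N = \<langle>(n22 - n23 - n31) *s e1 \<mid> n23 *s e1 + n22 *s e2 + n23 *s e3 \<mid> n31 *s e1 + (n22 - n23) *s e3\<rangle>) \<or>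
      (\<exists>n11 n12 n13. n12 \<noteq> 0 \<and> n13 \<noteq> 0 \<and> N = \<langle>n11 *s e1 + n12 *s e2 + n13 *s e3 \<mid> (n11 - n12) *s e2 \<mid> (n11 - n13) *s e3\<rangle>) \<or>
      (\<exists>n11 n12 n32. n12 \<noteq> 0 \<and> n32 \<noteq> 0 \<and> N = \<langle>n11 *s e1 + n12 *s e2 + n12 *s e3 \<mid> (n11 - n12 - n32) *s e2 \<mid> n32 *s e2 + (n11 - n12) *s e3\<rangle>) \<or>
      (\<exists>n11 n12 n23. n12 \<noteq> 0 \<and> n23 \<noteq> 0 \<and> N = \<langle>n11 *s e1 + n12 *s e2 + n12 *s e3 \<mid> (n11 - n12) *s e2 + n23 *s e3 \<mid> (n11 - n12 - n23) *s e3\<rangle>)) \<and>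
    (\<forall>N. nijenhuis_operator C6 N \<longleftrightarrow>
      (\<exists>n11 n22 n33. N = \<langle>n11 *s e1 \<mid> n22 *s e2 \<mid> n33 *s e3\<rangle>) \<or>
      (\<exists>n11 n22 n31. n31 \<noteq> 0 \<and> N = \<langle>n11 *s e1 \<mid> n22 *s e2 \<mid> n31 *s e1 + n11 *s e3\<rangle>) \<or>
      (\<exists>n11 n21 n33. n21 \<noteq> 0 \<and> N = \<langle>n11 *s e1 \<mid> n21 *s e1 + n11 *s e2 \<mid> n33 *s e3\<rangle>) \<or>
      (\<exists>n11 n21 n31. n21 \<noteq> 0 \<and> n31 \<noteq> 0 \<and> N = \<langle>n11 *s e1 \<mid> n21 *s e1 + n11 *s e2 \<mid> n31 *s e1 + n11 *s e3\<rangle>) \<or>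
      (\<exists>n11 n22 n32. n32 \<noteq> 0 \<and> N = \<langle>n11 *s e1 \<mid> n22 *s e2 \<mid> n32 *s e2 + (n22 + n32) *s e3\<rangle>) \<or>
      (\<exists>n11 n23 n33. n23 \<noteq> 0 \<and> N = \<langle>n11 *s e1 \<mid> (n23 + n33) *s e2 + n23 *s e3 \<mid> n33 *s e3\<rangle>) \<or>
      (\<exists>n22 n31 n32. n31 \<noteq> 0 \<and> n32 \<noteq> 0 \<and> N = \<langle>(n22 + n32) *s e1 \<mid> n22 *s e2 \<mid> n31 *s e1 + n32 *s e2 + (n22 + n32) *s e3\<rangle>) \<or>
      (\<exists>n21 n23 n33. n21 \<noteq> 0 \<and> n23 \<noteq> 0 \<and> N = \<langle>(n23 + n33) *s e1 \<mid> n21 *s e1 + (n23 + n33) *s e2 + n23 *s e3 \<mid> n33 *s e3\<rangle>)) \<and>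
    (\<forall>N. nijenhuis_operator C7 N \<longleftrightarrow>
      (\<exists>n11 n22 n33. N = \<langle>n11 *s e1 \<mid> n22 *s e2 \<mid> n33 *s e3\<rangle>) \<or>
      (\<exists>n11 n22 n31. n31 \<noteq> 0 \<and> N = \<langle>n11 *s e1 \<mid> n22 *s e2 \<mid> n31 *s e1 + n11 *s e3\<rangle>) \<or>
      (\<exists>n11 n21 n31. n21 \<noteq> 0 \<and> N = \<langle>n11 *s e1 \<mid> n21 *s e1 + n11 *s e2 \<mid> n31 *s e1 + n11 *s e3\<rangle>) \<or>
      (\<exists>n22 n31 n32. n31 \<noteq> 0 \<and> n32 \<noteq> 0 \<and> N = \<langle>(n22 + n32) *s e1 \<mid> n22 *s e2 \<mid> n31 *s e1 + n32 *s e2 + (n22 + n32) *s e3\<rangle>) \<or>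
      (\<exists>n11 n22 n32. n32 \<noteq> 0 \<and> N = \<langle>n11 *s e1 \<mid> n22 *s e2 \<mid> n32 *s e2 + (n22 + n32) *s e3\<rangle>) \<or>
      (\<exists>n11 n23 n33. n23 \<noteq> 0 \<and> N = \<langle>n11 *s e1 \<mid> (n23 + n33) *s e2 + n23 *s e3 \<mid> n33 *s e3\<rangle>) \<or>
      (\<exists>n21 n22 n32. n21 \<noteq> 0 \<and> n32 \<noteq> 0 \<and> N = \<langle>n22 *s e1 \<mid> n21 *s e1 + n22 *s e2 \<mid> (- n21) *s e1 + n32 *s e2 + (n22 + n32) *s e3\<rangle>) \<or>
      (\<exists>n11 n21 n23. n21 \<noteq> 0 \<and> n23 \<noteq> 0 \<and> N = \<langle>n11 *s e1 \<mid> n21 *s e1 + (n23 + n11) *s e2 + n23 *s e3 \<mid> (- n21) *s e1 + n11 *s e3\<rangle>)) \<and>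
    (\<forall>N. nijenhuis_operator C8 N \<longleftrightarrow>
      (\<exists>n11 n12 n21 n22 n33. N = \<langle>n11 *s e1 + n12 *s e2 \<mid> n21 *s e1 + n22 *s e2 \<mid> n33 *s e3\<rangle>) \<or>
      (\<exists>n11 n12 n22 n32. n32 \<noteq> 0 \<and> N = \<langle>n11 *s e1 + n12 *s e2 \<mid> n22 *s e2 \<mid> n32 *s e2 + n22 *s e3\<rangle>) \<or>
      (\<exists>n21 n22 n31 n32 n33. n31 \<noteq> 0 \<and> N = \<langle>(n33 - n21 * n32 / n31) *s e1 + ((n32 * n33 - n22 * n32) / n31) *s e2 \<mid> n21 *s e1 + n22 *s e2 \<mid> n31 *s e1 + n32 *s e2 + n33 *s e3\<rangle>)) \<and>
    (\<forall>N. nijenhuis_operator C9 N \<longleftrightarrow>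
      (\<exists>n11 n22 n33. N = \<langle>n11 *s e1 \<mid> n22 *s e2 \<mid> n33 *s e3\<rangle>) \<or>
      (\<exists>n11 n22 n32. n32 \<noteq> 0 \<and> N = \<langle>n11 *s e1 \<mid> n22 *s e2 \<mid> n32 *s e2 + n22 *s e3\<rangle>) \<or>
      (\<exists>n11 n22 n31. n31 \<noteq> 0 \<and> N = \<langle>n11 *s e1 \<mid> n22 *s e2 \<mid> n31 *s e1 + n11 *s e3\<rangle>) \<or>
      (\<exists>n11 n31 n32. n31 \<noteq> 0 \<and> n32 \<noteq> 0 \<and> N = \<langle>n11 *s e1 \<mid> n11 *s e2 \<mid> n31 *s e1 + n32 *s e2 + n11 *s e3\<rangle>) \<or>
      (\<exists>n11 n21 n22 n31. n21 \<noteq> 0 \<and> N = \<langle>n11 *s e1 \<mid> n21 *s e1 + n22 *s e2 \<mid> n31 *s e1 + n11 *s e3\<rangle>) \<or>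
      (\<exists>n11 n12 n22 n32. n12 \<noteq> 0 \<and> N = \<langle>n11 *s e1 + n12 *s e2 \<mid> n22 *s e2 \<mid> n32 *s e2 + n22 *s e3\<rangle>)) \<and>
    (\<forall>N. nijenhuis_operator C10 N \<longleftrightarrow>
      (\<exists>n11 n12 n21 n22 n33. N = \<langle>n11 *s e1 + n12 *s e2 \<mid> n21 *s e1 + n22 *s e2 \<mid> n33 *s e3\<rangle>) \<or>
      (\<exists>n11 n12 n22 n32. n32 \<noteq> 0 \<and> N = \<langle>n11 *s e1 + n12 *s e2 \<mid> n22 *s e2 \<mid> n32 *s e2 + n22 *s e3\<rangle>) \<or>
      (\<exists>n21 n22 n31 n32 n33. n31 \<noteq> 0 \<and> N = \<langle>(n33 - n21 * n32 / n31) *s e1 + ((n32 * n33 - n22 * n32) / n31) *s e2 \<mid> n21 *s e1 + n22 *s e2 \<mid> n31 *s e1 + n32 *s e2 + n33 *s e3\<rangle>)) \<and>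
    (\<forall>N. nijenhuis_operator C11 N \<longleftrightarrow>
      (\<exists>n11 n12 n33. N = \<langle>n11 *s e1 + n12 *s e2 \<mid> n11 *s e2 \<mid> n33 *s e3\<rangle>) \<or>
      (\<exists>n11 n12 n32. n32 \<noteq> 0 \<and> N = \<langle>n11 *s e1 + n12 *s e2 \<mid> n11 *s e2 \<mid> n32 *s e2 + n11 *s e3\<rangle>) \<or>
      (\<exists>n11 n31 n32. n31 \<noteq> 0 \<and> N = \<langle>n11 *s e1 - n31 *s e2 \<mid> n11 *s e2 \<mid> n31 *s e1 + n32 *s e2 + n11 *s e3\<rangle>)) \<and>
    (\<forall>N. nijenhuis_operator C12 N \<longleftrightarrow>
      (\<exists>n11 n12 n33. N = \<langle>n11 *s e1 + n12 *s e2 \<mid> n11 *s e2 \<mid> n33 *s e3\<rangle>) \<or>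
      (\<exists>n11 n12 n32. n32 \<noteq> 0 \<and> N = \<langle>n11 *s e1 + n12 *s e2 \<mid> n11 *s e2 \<mid> n32 *s e2 + n11 *s e3\<rangle>) \<or>
      (\<exists>n11 n31 n32. n31 \<noteq> 0 \<and> N = \<langle>n11 *s e1 + n31 *s e2 \<mid> n11 *s e2 \<mid> n31 *s e1 + n32 *s e2 + n11 *s e3\<rangle>))"
proof (intro conjI, goal_cases)
  case 1
  show ?case
  proof (rule nijenhuis_classification, goal_cases)
    \<comment> \<open>Goal 2 is the equivalence for maps given by entries; goal 1, linearity of the
      listed maps, is closed at \<open>qed\<close>.\<close>
    case (2 a b c d e f g h k)
    show ?case
      \<comment> \<open>Squares force \<open>c = f = 0\<close>; then \<open>(e3, e3)\<close> leaves
        \<open>(k - a)^2 = - b * d\<close> and \<open>b * (2 * k - a - e) = 0\<close>, so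
        \<open>b\<close> decides the family.\<close>
      by (simp add: nijenhuis_expand matrix_map_eq_iff)
        (cases "b = 0"; auto simp: factor power2_eq_square divide_simps; algebra)
  qed (auto simp: linear_linear_map_of)
next
  case 2
  have "C2 x y = 0" for x y
    by (simp add: C2_def product_of_table_def)
  \<comment> \<open>With all products zero, this is all that remains of the identity.\<close>
  moreover have "N (- N 0) = 0" if "Vector_Spaces.linear (*s) (*s) N"
    for N :: "complex ^ 3 \<Rightarrow> complex ^ 3"
    using vec.linear_0[OF that] by simp
  ultimately show ?case
    by (auto simp: nijenhuis_operator_def)
next
  case 3
  show ?case
  proof (rule nijenhuis_classification, goal_cases)
    case (2 a b c d e f g h k)
    show ?case
      \<comment> \<open>Here \<open>b = c = 0\<close>, and \<open>(e2, e3)\<close> gives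
        \<open>(e - a) * h + f * (k - a) = 0\<close>. If \<open>f\<close> and \<open>h\<close> are
        both nonzero, the signs in \<open>e = a \<plusminus> f * \<i>\<close> and
        \<open>k = a \<plusminus> h * \<i>\<close> must be opposite, whence the last two
        families.\<close>
      by (simp add: matrix_map_eq_iff basis_components ex_sign conj_disj_distribL ex_disj_distrib,
          simp add: nijenhuis_expand)
        (cases "f = 0"; cases "h = 0"; simp add: sum_of_squares_factor factor(4) cong: conj_cong;
          auto; simp add: algebra_simps)
  qed (auto simp: linear_linear_map_of)
next
  case 4
  show ?case
  proof (rule nijenhuis_classification, goal_cases)
    case (2 a b c d e f g h k)
    show ?case
      by (simp add: nijenhuis_expand matrix_map_eq_iff)
        (auto simp: factor; simp add: algebra_simps)
  qed (auto simp: linear_linear_map_of)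
next
  case 5
  show ?case
  proof (rule nijenhuis_classification, goal_cases)
    case (2 a b c d e f g h k)
    show ?case
      \<comment> \<open>The sixteen families have pairwise distinct sets of nonzero off-diagonal
        entries; every other pattern is contradictory.\<close>
      by (simp add: nijenhuis_expand matrix_map_eq_iff)
        (cases "b = 0"; cases "c = 0"; cases "d = 0"; cases "f = 0"; cases "g = 0"; cases "h = 0";
          simp add: factor; auto simp: algebra_simps factor)
  qed (auto simp: linear_linear_map_of)
next
  case 6
  show ?case
  proof (rule nijenhuis_classification, goal_cases)
    case (2 a b c d e f g h k)
    show ?case
      \<comment> \<open>The nilradical, spanned by \<open>e1\<close>, is preserved, so
        \<open>b = c = 0\<close>; moreover \<open>f * h = 0\<close>.\<close>
      by (simp add: nijenhuis_expand matrix_map_eq_iff)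
        (cases "b = 0"; cases "c = 0"; cases "d = 0"; cases "f = 0"; cases "g = 0"; cases "h = 0";
          simp add: factor; auto simp: algebra_simps factor)
  qed (auto simp: linear_linear_map_of)
next
  case 7
  show ?case
  proof (rule nijenhuis_classification, goal_cases)
    case (2 a b c d e f g h k)
    show ?case
      \<comment> \<open>Again \<open>b = c = 0\<close> and \<open>f * h = 0\<close>. If
        \<open>d\<close> and \<open>h\<close> are nonzero, \<open>k - a = h\<close> and
        \<open>g * (k - a) = - h * d\<close> yield \<open>g = - d\<close>; the case of nonzero
        \<open>d\<close> and \<open>f\<close> leads to the same relation.\<close>
      by (simp add: nijenhuis_expand matrix_map_eq_iff)
        (cases "b = 0"; cases "c = 0"; cases "d = 0"; cases "f = 0"; cases "g = 0"; cases "h = 0";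
          simp add: factor; auto simp: algebra_simps factor)
  qed (auto simp: linear_linear_map_of)
next
  case 8
  show ?case
  proof (rule nijenhuis_classification, goal_cases)
    case (2 a b c d e f g h k)
    show ?case
      \<comment> \<open>From here on \<open>e1\<close> and \<open>e2\<close> span the nilradical and
        \<open>c = f = 0\<close>, so four entries are split. For \<open>C8\<close> the row
        \<open>(g, h)\<close> times the upper left block must equal \<open>k\<close> times
        \<open>(g, h)\<close>; for nonzero \<open>g\<close> this is solved for \<open>a\<close> and
        \<open>b\<close>.\<close>
      by (simp add: nijenhuis_expand matrix_map_eq_iff)
        (cases "b = 0"; cases "d = 0"; cases "g = 0"; cases "h = 0";
          auto simp: factor eq_divide_iff; algebra)
  qed (auto simp: linear_linear_map_of)
next
  case 9
  show ?case
  proof (rule nijenhuis_classification, goal_cases)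
    case (2 a b c d e f g h k)
    show ?case
      \<comment> \<open>One has \<open>b * d = 0\<close>. Nonzero \<open>b\<close> forces
        \<open>k = e\<close> and \<open>g = 0\<close>, nonzero \<open>d\<close> forces
        \<open>k = a\<close> and \<open>h = 0\<close>; otherwise \<open>g * (k - a) = 0\<close> and
        \<open>h * (k - e) = 0\<close>.\<close>
      by (simp add: nijenhuis_expand matrix_map_eq_iff)
        (cases "b = 0"; cases "d = 0"; cases "g = 0"; cases "h = 0";
          auto simp: factor eq_divide_iff; algebra)
  qed (auto simp: linear_linear_map_of)
next
  case 10
  show ?case
  proof (rule nijenhuis_classification, goal_cases)
    case (2 a b c d e f g h k)
    show ?case
      \<comment> \<open>Now \<open>e3\<close> is a unit, yet the same eigenvector condition as for
        \<open>C8\<close> results.\<close>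
      by (simp add: nijenhuis_expand matrix_map_eq_iff)
        (cases "b = 0"; cases "d = 0"; cases "g = 0"; cases "h = 0";
          auto simp: factor eq_divide_iff; algebra)
  qed (auto simp: linear_linear_map_of)
next
  case 11
  show ?case
  proof (rule nijenhuis_classification, goal_cases)
    case (2 a b c d e f g h k)
    show ?case
      \<comment> \<open>Here \<open>d = 0\<close> and \<open>a = e\<close>; for nonzero
        \<open>g\<close>, \<open>(e3, e3)\<close> gives \<open>k = a\<close> and
        \<open>g * g = - g * b\<close>.\<close>
      by (simp add: nijenhuis_expand matrix_map_eq_iff)
        (cases "b = 0"; cases "d = 0"; cases "g = 0"; cases "h = 0";
          auto simp: factor eq_divide_iff; algebra)
  qed (auto simp: linear_linear_map_of)
next
  case 12
  show ?case
  proof (rule nijenhuis_classification, goal_cases)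
    case (2 a b c d e f g h k)
    show ?case
      \<comment> \<open>As for \<open>C11\<close>, but the unit \<open>e3\<close> turns the last
        relation into \<open>g * g = g * b\<close>, hence the opposite sign of
        \<open>b\<close>.\<close>
      by (simp add: nijenhuis_expand matrix_map_eq_iff)
        (cases "b = 0"; cases "d = 0"; cases "g = 0"; cases "h = 0";
          auto simp: factor eq_divide_iff; algebra)
  qed (auto simp: linear_linear_map_of)
qed

end
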